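(* For every closed interval $[a,b]\subset[0,1]$, as $X\to\infty$, $$\#\Omega_{[a,b]}(X)=\frac{(b-a)}{4}X^4+O(X^3),$$ and in particular $$\lim_{X\to\infty}\frac{\#\Omega_{[a,b]}(X)}{\#\Omega(X)}=b-a.$$
   Context: For positive integers $p,q$ (not necessarily coprime) let $T_{p,q}$ be the $(p,q)$-torus link, $d=\gcd(p,q)$ (its number of components) and $L=\operatorname{lcm}(p,q)$. Its single-variable Alexander polynomial (for $d\ge 2$ obtained from the multivariable Alexander polynomial $\Delta_{T_{p,q}}(X_1,\dots,X_d)$ as $(t-1)\Delta_{T_{p,q}}(t,\dots,t)$, and for $d=1$ the usual Alexander polynomial) is $$\Delta_{p,q}(t)=\frac{(t^{L}-1)^{d}(t-1)}{(t^{p}-1)(t^{q}-1)}.$$ All its roots are roots of unity. For $X>0$, $\mathcal{T}(X)$ is the set of all torus links $T_{p,q}$ with $1\le p,q\le X$, indexed by the ordered pairs $(p,q)$. $\Omega(X)$ is the multiset of pairs $(T_{p,q},\alpha)$ with $T_{p,q}\in\mathcal{T}(X)$ and $\alpha$ a root of $\Delta_{p,q}(t)$, counted with the multiplicity of $\alpha$ as a root. $\Omega_{[a,b]}(X)$ is the sub-multiset of those pairs for which $\alpha$ lies on the arc $\{e^{2\pi i\theta}:\theta\in[a,b]\}$. Cardinalities count multiplicity. $f(X)=g(X)+O(h(X))$ has its usual meaning: $|f(X)-g(X)|\le C\,h(X)$ for some constant $C$ and all sufficiently large $X$. *)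

theory Defs
  imports
    "HOL-Analysis.Analysis"
    "HOL-Computational_Algebra.Computational_Algebra"
    "HOL-Library.Landau_Symbols"
begin

text \<open>
  Torus links are indexed by ordered pairs of positive integers, so the link \<open>T\<^sub>p\<^sub>,\<^sub>q\<close> is
  represented by its index \<open>(p, q)\<close>; \<open>(p, q)\<close> and \<open>(q, p)\<close> count as different elements.
\<close>

type_synonym torus_link = "nat \<times> nat"

definition torus_links :: "real \<Rightarrow> torus_link set" where
  "torus_links X = {(p, q). 1 \<le> p \<and> real p \<le> X \<and> 1 \<le> q \<and> real q \<le> X}"

definition unity_poly :: "nat \<Rightarrow> complex poly" where
  "unity_poly n = monom 1 n - 1"

text \<open>
  The single-variable Alexander polynomial of \<open>T\<^sub>p\<^sub>,\<^sub>q\<close>, by its closed formula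
  \<open>(t\<^sup>L - 1)\<^sup>d (t - 1) / ((t\<^sup>p - 1) (t\<^sup>q - 1))\<close> with \<open>d = gcd p q\<close> and \<open>L = lcm p q\<close>. The operation
  \<open>div\<close> is polynomial division; for positive \<open>p\<close>, \<open>q\<close> it is exact, see
  \<open>torus_alexander_poly_mult\<close> below.
\<close>

definition torus_alexander_poly :: "torus_link \<Rightarrow> complex poly" where
  "torus_alexander_poly = (\<lambda>(p, q).
     (unity_poly (lcm p q) ^ gcd p q * unity_poly 1) div (unity_poly p * unity_poly q))"

definition Omega :: "real \<Rightarrow> (torus_link \<times> complex) multiset" where
  "Omega X = (\<Sum>T\<in>torus_links X. image_mset (\<lambda>\<alpha>. (T, \<alpha>)) (proots (torus_alexander_poly T)))"

definition circle_arc :: "real \<Rightarrow> real \<Rightarrow> complex set" where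
  "circle_arc a b = {exp (2 * of_real pi * \<i> * of_real \<theta>) | \<theta>. \<theta> \<in> {a..b}}"

definition Omega_arc :: "real \<Rightarrow> real \<Rightarrow> real \<Rightarrow> (torus_link \<times> complex) multiset" where
  "Omega_arc a b X = filter_mset (\<lambda>(T, \<alpha>). \<alpha> \<in> circle_arc a b) (Omega X)"

lemma finite_torus_links: "finite (torus_links X)"
proof (rule finite_subset)
  show "torus_links X \<subseteq> {..nat \<lfloor>X\<rfloor>} \<times> {..nat \<lfloor>X\<rfloor>}"
    by (auto simp: torus_links_def le_nat_floor)
qed auto

lemma unity_poly_nonzero: "n > 0 \<Longrightarrow> unity_poly n \<noteq> 0"
  by (auto simp: unity_poly_def poly_eq_iff dest: spec[of _ n])

lemma order_unity_poly:
  assumes "n > 0"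
  shows "order x (unity_poly n) = (if x ^ n = 1 then 1 else 0)"
proof -
  have "rsquarefree (unity_poly n)"
    using assms by (auto simp: rsquarefree_roots unity_poly_def poly_monom pderiv_diff pderiv_monom
                               power_0_left)
  then have "order x (unity_poly n) = 1" if "poly (unity_poly n) x = 0"
    using that unity_poly_nonzero[OF assms] rsquarefree_root_order by blast
  moreover have "poly (unity_poly n) x = x ^ n - 1"
    by (simp add: unity_poly_def poly_monom)
  ultimately show ?thesis
    by (auto simp: order_0I)
qed

lemma proots_subset_imp_dvd:
  fixes f g :: "complex poly"
  assumes "f \<noteq> 0" "proots f \<subseteq># proots g"
  shows "f dvd g"
proof -
  have "(\<Prod>x\<in>#proots f. [:-x, 1:]) dvd (\<Prod>x\<in>#proots g. [:-x, 1:])"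
    using assms(2) by (intro prod_mset_subset_imp_dvd image_mset_subseteq_mono)
  then have "smult (lead_coeff f) (\<Prod>x\<in>#proots f. [:-x, 1:]) dvd
             smult (lead_coeff g) (\<Prod>x\<in>#proots g. [:-x, 1:])"
    using assms(1) by (simp add: smult_dvd_iff dvd_smult)
  then show ?thesis
    by (simp only: complex_poly_decompose_multiset)
qed

lemma torus_alexander_poly_mult:
  assumes "p > 0" "q > 0"
  shows "torus_alexander_poly (p, q) * (unity_poly p * unity_poly q) =
           unity_poly (lcm p q) ^ gcd p q * unity_poly 1"
proof -
  have L: "lcm p q > 0" using assms by (simp add: lcm_pos_nat)
  have d: "gcd p q > 0" using assms by simp
  have one: "x = 1" if "coprime p q" "x ^ p = 1" "x ^ q = 1" for x :: complex
  proof -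
    obtain u v where "u * p = v * q + 1"
      using bezout_nat[of p q] \<open>coprime p q\<close> assms by (auto simp: mult.commute)
    then have "x ^ (p * u) = x ^ (q * v) * x" by (simp add: mult.commute)
    then show ?thesis using that by (simp add: power_mult)
  qed
  have lcm1: "x ^ lcm p q = 1" if "x ^ p = 1 \<or> x ^ q = 1" for x :: complex
  proof -
    obtain k l where "lcm p q = p * k" "lcm p q = q * l"
      by (meson dvdE dvd_lcm1 dvd_lcm2)
    then show ?thesis using that by (metis power_mult power_one)
  qed
  have "proots (unity_poly p * unity_poly q) \<subseteq># proots (unity_poly (lcm p q) ^ gcd p q * unity_poly 1)"
  proof (rule mset_subset_eqI)
    fix x
    have cnt: "count (proots (unity_poly n)) x = (if x ^ n = 1 then 1 else 0)" if "n > 0" for n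
      using that by (simp add: order_unity_poly unity_poly_nonzero)
    have *: "count (proots (unity_poly p * unity_poly q)) x =
        (if x ^ p = 1 then 1 else 0) + (if x ^ q = 1 then 1 else 0)"
      using assms by (simp add: proots_mult unity_poly_nonzero cnt del: count_proots)
    have **: "count (proots (unity_poly (lcm p q) ^ gcd p q * unity_poly 1)) x =
        gcd p q * (if x ^ lcm p q = 1 then 1 else 0) + (if x = 1 then 1 else 0)"
      using L cnt[of 1]
      by (simp add: proots_mult proots_power unity_poly_nonzero cnt del: count_proots)
    show "count (proots (unity_poly p * unity_poly q)) x \<le>
          count (proots (unity_poly (lcm p q) ^ gcd p q * unity_poly 1)) x"
    proof (cases "gcd p q = 1")
      case True
      then show ?thesis
        unfolding * ** using one[of x] lcm1[of x] by (auto simp: coprime_iff_gcd_eq_1)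
    next
      case False
      then have "gcd p q \<ge> 2" using d by linarith
      then show ?thesis unfolding * ** using lcm1[of x] by auto
    qed
  qed
  then have "unity_poly p * unity_poly q dvd unity_poly (lcm p q) ^ gcd p q * unity_poly 1"
    using assms by (intro proots_subset_imp_dvd) (auto simp: unity_poly_nonzero)
  then show ?thesis
    by (simp add: torus_alexander_poly_def)
qed

end

theory Submission
  imports Defs "HOL-Real_Asymp.Real_Asymp"
begin

text \<open>
  An arc of length \<open>b - a\<close> (in turns) contains \<open>n (b - a) + O(1)\<close> of the \<open>n\<close>-th roots of unity.
  The closed formula for the Alexander polynomial expresses its root multiset through the roots of
  unity of orders \<open>L\<close>, \<open>1\<close>, \<open>p\<close>, \<open>q\<close>, and \<open>gcd p q * L = p q\<close>, so a link contributes
  \<open>(b - a) p q + O(X)\<close> roots. Summation over the \<open>\<lfloor>X\<rfloor>\<^sup>2\<close> links gives the claim, as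
  \<open>1 + \<dots> + \<lfloor>X\<rfloor> = X\<^sup>2 / 2 + O(X)\<close>.
\<close>

section \<open>Roots of unity on an arc\<close>

definition arc_roots :: "real \<Rightarrow> real \<Rightarrow> nat \<Rightarrow> complex set" where
  "arc_roots a b n = {x. x ^ n = 1 \<and> x \<in> circle_arc a b}"

lemma circle_arc_cis: "circle_arc a b = (\<lambda>\<theta>. cis (2 * pi * \<theta>)) ` {a..b}"
  unfolding circle_arc_def cis_conv_exp by (auto simp: mult_ac image_iff)

text \<open>If \<open>cis (2 * pi * t)\<close> is an \<open>n\<close>-th root of unity, then
  \<open>n * t\<close> is an integer \<open>k\<close>, so \<open>t = k / n\<close>; as
  \<open>0 \<le> a\<close>, this \<open>k\<close> is a natural number. The map need not be injective
  on these \<open>k\<close>, since \<open>0\<close> and \<open>n\<close> may both occur.\<close>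

lemma arc_roots_eq_image:
  assumes "n > 0" "0 \<le> a"
  shows "arc_roots a b n =
    (\<lambda>k. cis (2 * pi * real k / real n)) ` {k. real n * a \<le> real k \<and> real k \<le> real n * b}"
    (is "_ = ?f ` ?K")
proof (intro equalityI subsetI)
  fix x assume "x \<in> arc_roots a b n"
  then obtain t where t: "x ^ n = 1" "x = cis (2 * pi * t)" "a \<le> t" "t \<le> b"
    by (auto simp: arc_roots_def circle_arc_cis)
  from t(1) have "cis (real n * (2 * pi * t)) = 1"
    by (simp add: t(2) Complex.DeMoivre)
  then have "exp (\<i> * complex_of_real (real n * (2 * pi * t))) = 1"
    by (simp only: cis_conv_exp)
  then obtain m :: int where "real n * (2 * pi * t) = real_of_int (2 * m) * pi"
    by (auto simp: exp_eq_1)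
  then have m: "real n * t = real_of_int m"
    by simp
  moreover have "0 \<le> real n * t"
    using t assms by simp
  ultimately have "real_of_int m \<ge> 0" by simp
  then have k: "real n * t = real (nat m)"
    using m by simp
  then have "t = real (nat m) / real n"
    using assms by (simp add: field_simps)
  then have "x = ?f (nat m)"
    using t(2) by simp
  moreover have "nat m \<in> ?K"
    using t(3,4) by (simp add: k[symmetric] mult_left_mono)
  ultimately show "x \<in> ?f ` ?K" by blast
next
  fix x assume "x \<in> ?f ` ?K"
  then obtain k where k: "x = ?f k" "real n * a \<le> real k" "real k \<le> real n * b"
    by blast
  have "x ^ n = cis (2 * pi * real k)"
    using assms by (simp add: k(1) Complex.DeMoivre)
  then have "x ^ n = 1"
    by (simp add: cis_multiple_2pi)
  moreover have "x \<in> circle_arc a b"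
    unfolding circle_arc_cis
    by (rule image_eqI[of _ _ "real k / real n"]) (use k assms in \<open>auto simp: field_simps\<close>)
  ultimately show "x \<in> arc_roots a b n"
    by (simp add: arc_roots_def)
qed

lemma card_nat_interval_approx:
  fixes x y :: real
  assumes "0 \<le> x" "x \<le> y"
  shows "\<bar>real (card {k::nat. x \<le> real k \<and> real k \<le> y}) - (y - x)\<bar> \<le> 1"
proof -
  have "{k::nat. x \<le> real k \<and> real k \<le> y} = {nat \<lceil>x\<rceil>..nat \<lfloor>y\<rfloor>}"
    using assms by (auto simp: le_nat_iff nat_le_iff le_floor_iff ceiling_le_iff)
  \<comment> \<open>The first bound keeps the cardinality formula valid when \<open>[x, y]\<close>
    contains no integer: then both sides are \<open>0\<close>.\<close>
  moreover have "\<lceil>x\<rceil> \<le> \<lfloor>y\<rfloor> + 1" "0 \<le> \<lceil>x\<rceil>" "0 \<le> \<lfloor>y\<rfloor>"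
    using assms by linarith+
  ultimately have "real (card {k::nat. x \<le> real k \<and> real k \<le> y}) = \<lfloor>y\<rfloor> + 1 - \<lceil>x\<rceil>"
    by (simp add: of_nat_diff nat_le_iff)
  then show ?thesis by linarith
qed

text \<open>The error \<open>2\<close> is made up of \<open>1\<close> for counting integers in
  \<open>[n * a, n * b]\<close> and \<open>1\<close> for the only possible coincidence of two
  indices.\<close>

lemma card_arc_roots_approx:
  assumes "n > 0" "0 \<le> a" "a \<le> b" "b \<le> 1"
  shows "\<bar>real (card (arc_roots a b n)) - real n * (b - a)\<bar> \<le> 2"
proof -
  define K where "K = {k. real n * a \<le> real k \<and> real k \<le> real n * b}"
  define f where "f = (\<lambda>k. cis (2 * pi * real k / real n))"
  have img: "arc_roots a b n = f ` K"
    using arc_roots_eq_image[OF assms(1,2)] by (simp add: f_def K_def)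
  have "k \<le> n" if "k \<in> K" for k
  proof -
    have "real k \<le> real n * b" using that by (simp add: K_def)
    also have "\<dots> \<le> real n * 1" using assms by (intro mult_left_mono) auto
    finally show ?thesis by simp
  qed
  then have sub: "K - {n} \<subseteq> {..<n}" "finite K"
    by (force, meson atMost_iff finite_atMost finite_subset subsetI)
  \<comment> \<open>The indices \<open>0\<close> and \<open>n\<close> give the same root.\<close>
  have "inj_on f (K - {n})"
    using Complex.bij_betw_roots_unity[OF assms(1)] sub(1)
    by (auto simp: f_def bij_betw_def intro: inj_on_subset)
  then have "card (K - {n}) \<le> card (f ` K)"
    using sub(2) by (metis card_image card_mono finite_imageI image_mono Diff_subset)
  moreover have "card K \<le> card (K - {n}) + 1"
    using sub(2) card_Suc_Diff1[of K n] by (cases "n \<in> K") auto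
  moreover have "card (f ` K) \<le> card K"
    using sub(2) by (rule card_image_le)
  moreover have "\<bar>real (card K) - (real n * b - real n * a)\<bar> \<le> 1"
    unfolding K_def using assms by (intro card_nat_interval_approx mult_left_mono) auto
  ultimately show ?thesis
    unfolding img right_diff_distrib by linarith
qed

text \<open>This crude bound suffices for the orders \<open>p\<close>, \<open>q\<close> and
  \<open>1\<close>, which enter only the error term.\<close>

lemma card_arc_roots_le: "n > 0 \<Longrightarrow> card (arc_roots a b n) \<le> n"
proof -
  assume n: "n > 0"
  have "card (arc_roots a b n) \<le> card {z::complex. z ^ n = 1}"
    using n by (intro card_mono finite_roots_unity) (auto simp: arc_roots_def)
  then show ?thesis
    using card_roots_unity_eq[OF n] by simp
qed

lemma proots_unity_poly:
  assumes "n > 0"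
  shows "proots (unity_poly n) = mset_set {x. x ^ n = 1}"
  using assms finite_roots_unity[of n, where ?'a = complex]
  by (intro multiset_eqI) (auto simp: order_unity_poly unity_poly_nonzero count_mset_set')

section \<open>Roots of one Alexander polynomial on an arc\<close>

definition arc_root_count :: "real \<Rightarrow> real \<Rightarrow> complex poly \<Rightarrow> nat" where
  "arc_root_count a b f = size (filter_mset (\<lambda>x. x \<in> circle_arc a b) (proots f))"

lemma arc_root_count_mult:
  "f \<noteq> 0 \<Longrightarrow> g \<noteq> 0 \<Longrightarrow> arc_root_count a b (f * g) = arc_root_count a b f + arc_root_count a b g"
  by (simp add: arc_root_count_def proots_mult)

lemma arc_root_count_power:
  "f \<noteq> 0 \<Longrightarrow> arc_root_count a b (f ^ k) = k * arc_root_count a b f"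
  by (induction k) (simp_all add: arc_root_count_mult, simp add: arc_root_count_def)

lemma arc_root_count_unity_poly:
  assumes "n > 0"
  shows "arc_root_count a b (unity_poly n) = card (arc_roots a b n)"
  using assms finite_roots_unity[of n, where ?'a = complex]
  by (simp add: arc_root_count_def proots_unity_poly arc_roots_def)

lemma torus_alexander_poly_nonzero:
  "p > 0 \<Longrightarrow> q > 0 \<Longrightarrow> torus_alexander_poly (p, q) \<noteq> 0"
  using torus_alexander_poly_mult[of p q]
  by (auto simp: unity_poly_nonzero lcm_pos_nat)

text \<open>Counting with multiplicity turns the product identity for the polynomial into a linear
  one. The terms for \<open>p\<close> and \<open>q\<close> stay on the left to avoid truncated
  subtraction.\<close>

lemma arc_root_count_torus:
  assumes "p > 0" "q > 0"
  shows "arc_root_count a b (torus_alexander_poly (p, q)) +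
      card (arc_roots a b p) + card (arc_roots a b q) =
    gcd p q * card (arc_roots a b (lcm p q)) + card (arc_roots a b 1)"
  using arg_cong[OF torus_alexander_poly_mult[OF assms], of "arc_root_count a b"] assms
  by (simp add: arc_root_count_mult arc_root_count_power unity_poly_nonzero lcm_pos_nat
      arc_root_count_unity_poly torus_alexander_poly_nonzero)

text \<open>The roots of order dividing \<open>L = lcm p q\<close> give the main term, since
  \<open>d * L = p * q\<close> for \<open>d = gcd p q\<close>, with error at most
  \<open>2 * d\<close>. The remaining terms are at most \<open>p\<close>, \<open>q\<close> and
  \<open>1\<close>, and \<open>2 * d + p + q + 1 \<le> 5 * n\<close>.\<close>

lemma arc_root_count_torus_approx:
  assumes "0 \<le> a" "a \<le> b" "b \<le> 1" "p \<in> {1..n}" "q \<in> {1..n}"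
  shows "\<bar>real (arc_root_count a b (torus_alexander_poly (p, q))) - (b - a) * (real p * real q)\<bar>
    \<le> 5 * real n"
proof -
  have pq: "p > 0" "q > 0" "p \<le> n" "q \<le> n" using assms by auto
  define d where "d = gcd p q"
  define L where "L = lcm p q"
  have L: "L > 0" using pq by (simp add: L_def lcm_pos_nat)
  have "d \<le> p" using pq by (simp add: d_def)
  have dL: "real d * real L = real p * real q"
    unfolding d_def L_def by (metis of_nat_mult prod_gcd_lcm_nat)
  have "\<bar>real d * real (card (arc_roots a b L)) - (b - a) * (real p * real q)\<bar>
      = \<bar>real d * (real (card (arc_roots a b L)) - real L * (b - a))\<bar>"
    by (simp add: dL[symmetric] algebra_simps)
  also have "\<dots> = real d * \<bar>real (card (arc_roots a b L)) - real L * (b - a)\<bar>"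
    by (simp add: abs_mult)
  also have "\<dots> \<le> real d * 2"
    using card_arc_roots_approx[OF L assms(1-3)] by (intro mult_left_mono) auto
  finally have *: "\<bar>real d * real (card (arc_roots a b L)) - (b - a) * (real p * real q)\<bar>
      \<le> 2 * real d" by simp
  have "real (arc_root_count a b (torus_alexander_poly (p, q))) +
      real (card (arc_roots a b p)) + real (card (arc_roots a b q)) =
      real d * real (card (arc_roots a b L)) + real (card (arc_roots a b 1))"
    using arc_root_count_torus[OF pq(1,2), of a b]
    by (simp add: d_def L_def flip: of_nat_add of_nat_mult)
  then show ?thesis
    using * pq \<open>d \<le> p\<close> card_arc_roots_le[of p a b] card_arc_roots_le[of q a b]
      card_arc_roots_le[of 1 a b] by linarith
qed

section \<open>Summation over the links\<close>

lemma size_Omega_arc: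
  "size (Omega_arc a b X) = (\<Sum>T\<in>torus_links X. arc_root_count a b (torus_alexander_poly T))"
proof -
  \<comment> \<open>Stated for an arbitrary finite index set so that induction applies.\<close>
  have "size (filter_mset (\<lambda>(T, \<alpha>). \<alpha> \<in> circle_arc a b)
      (\<Sum>T\<in>S. image_mset (\<lambda>\<alpha>. (T, \<alpha>)) (proots (torus_alexander_poly T)))) =
    (\<Sum>T\<in>S. arc_root_count a b (torus_alexander_poly T))" if "finite S" for S
    using that
    by (induction S rule: finite_induct)
      (simp_all add: filter_mset_image_mset arc_root_count_def o_def)
  then show ?thesis
    by (simp add: Omega_arc_def Omega_def finite_torus_links)
qed

lemma torus_links_eq:
  assumes "X \<ge> 0"
  shows "torus_links X = {1..nat \<lfloor>X\<rfloor>} \<times> {1..nat \<lfloor>X\<rfloor>}"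
  using assms by (auto simp: torus_links_def le_nat_iff le_floor_iff)

text \<open>From \<open>X - 1 \<le> n \<le> X\<close>, the product \<open>n * (n + 1)\<close> lies
  between \<open>(X - 1) * X\<close> and \<open>X * (X + 1)\<close>. The squares of these bounds
  differ from \<open>X ^ 4\<close> by at most \<open>3 * X ^ 3\<close>, and division by
  \<open>4\<close> follows.\<close>

lemma triangular_square_approx:
  fixes X :: real
  assumes "X \<ge> 1" "n = nat \<lfloor>X\<rfloor>"
  shows "\<bar>(real n * (real n + 1) / 2)\<^sup>2 - X ^ 4 / 4\<bar> \<le> X ^ 3"
proof -
  have n: "real n \<le> X" "X \<le> real n + 1" "X - 1 \<le> real n"
    using assms by linarith+
  have "((X - 1) * X)\<^sup>2 \<le> (real n * (real n + 1))\<^sup>2"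
    using n assms by (intro power_mono mult_mono) auto
  moreover have "(real n * (real n + 1))\<^sup>2 \<le> (X * (X + 1))\<^sup>2"
    using n assms by (intro power_mono mult_mono) auto
  moreover have "((X - 1) * X)\<^sup>2 = X ^ 4 - 2 * X ^ 3 + X\<^sup>2" "(X * (X + 1))\<^sup>2 = X ^ 4 + 2 * X ^ 3 + X\<^sup>2"
    by algebra+
  moreover have "0 \<le> X\<^sup>2" "X\<^sup>2 \<le> X ^ 3"
    using assms by (auto intro: power_increasing)
  moreover have "(real n * (real n + 1) / 2)\<^sup>2 = (real n * (real n + 1))\<^sup>2 / 4"
    by (simp add: power_divide)
  ultimately show ?thesis
    by linarith
qed

text \<open>Of the constant \<open>6\<close>, the errors of at most \<open>5 * n\<close> over
  \<open>n * n\<close> links account for \<open>5\<close>, and replacing the sum of all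
  \<open>p * q\<close> by \<open>X ^ 4 / 4\<close> accounts for \<open>1\<close>.\<close>

lemma size_Omega_arc_approx:
  assumes "0 \<le> a" "a \<le> b" "b \<le> 1" "X \<ge> 1"
  shows "\<bar>real (size (Omega_arc a b X)) - (b - a) / 4 * X ^ 4\<bar> \<le> 6 * X ^ 3"
proof -
  define n where "n = nat \<lfloor>X\<rfloor>"
  define S where "S = {1..n} \<times> {1..n}"
  define c where "c = (\<lambda>T. real (arc_root_count a b (torus_alexander_poly T)))"
  define w where "w = (\<lambda>(p, q). real p * real q)"
  have n: "real n \<le> X" using assms by (simp add: n_def)
  have sz: "real (size (Omega_arc a b X)) = sum c S"
    using assms by (simp add: size_Omega_arc torus_links_eq S_def n_def c_def)
  have "(\<Sum>p=1..n. real p) = real n * (real n + 1) / 2"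
    using double_gauss_sum_from_Suc_0[of n, where ?'a = real] by simp
  \<comment> \<open>The weight \<open>p * q\<close> factors, so the double sum is the square of a
    triangular number.\<close>
  moreover have "sum w S = (\<Sum>p=1..n. real p)\<^sup>2"
    by (simp add: S_def w_def power2_eq_square sum_product sum.cartesian_product)
  ultimately have w: "sum w S = (real n * (real n + 1) / 2)\<^sup>2"
    by (simp only:)
  have "\<bar>sum c S - (b - a) * sum w S\<bar> = \<bar>\<Sum>T\<in>S. c T - (b - a) * w T\<bar>"
    by (simp add: sum_subtractf sum_distrib_left)
  also have "\<dots> \<le> (\<Sum>T\<in>S. \<bar>c T - (b - a) * w T\<bar>)"
    by (rule sum_abs)
  also have "\<dots> \<le> (\<Sum>T\<in>S. 5 * real n)"
    using arc_root_count_torus_approx[OF assms(1-3)]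
    by (intro sum_mono) (auto simp: S_def c_def w_def)
  also have "\<dots> = 5 * real n ^ 3"
    by (simp add: S_def power3_eq_cube)
  also have "\<dots> \<le> 5 * X ^ 3"
    using n by (simp add: power_mono)
  finally have "\<bar>sum c S - (b - a) * sum w S\<bar> \<le> 5 * X ^ 3" .
  moreover have "\<bar>(b - a) * sum w S - (b - a) / 4 * X ^ 4\<bar> \<le> X ^ 3"
  proof -
    have "\<bar>(b - a) * sum w S - (b - a) / 4 * X ^ 4\<bar> = (b - a) * \<bar>sum w S - X ^ 4 / 4\<bar>"
      using assms by (simp add: right_diff_distrib[symmetric] abs_mult flip: times_divide_eq_right)
    also have "\<dots> \<le> 1 * X ^ 3"
      unfolding w using triangular_square_approx[OF assms(4) n_def] assms by (intro mult_mono) auto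
    finally show ?thesis by simp
  qed
  ultimately show ?thesis
    unfolding sz by linarith
qed

section \<open>The full circle and the limit of the ratio\<close>

lemma circle_arc_full: "norm x = 1 \<Longrightarrow> x \<in> circle_arc 0 1"
proof -
  assume "norm x = 1"
  then obtain t where t: "0 \<le> t" "t < 2 * pi" "x = exp (\<i> * of_real t)"
    using complex_unimodular_polar[of x] by (auto simp: cis_conv_exp[symmetric] complex_eq_iff)
  then show ?thesis
    unfolding circle_arc_cis
    by (intro image_eqI[of _ _ "t / (2 * pi)"]) (auto simp: cis_conv_exp)
qed

text \<open>A root of the quotient is a root of the numerator, hence a root of unity.\<close>

lemma norm_root_torus_alexander_poly:
  assumes "p > 0" "q > 0" "poly (torus_alexander_poly (p, q)) x = 0"
  shows "norm x = 1"
proof -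
  have "poly (unity_poly (lcm p q) ^ gcd p q * unity_poly 1) x = 0"
    using torus_alexander_poly_mult[OF assms(1,2)] assms(3) by (metis mult_zero_left poly_mult)
  then have "x ^ lcm p q = 1 \<or> x = 1"
    by (auto simp: unity_poly_def poly_monom)
  then have "norm x ^ lcm p q = 1 ^ lcm p q"
    by (auto simp flip: norm_power)
  moreover have "lcm p q > 0"
    using assms by (simp add: lcm_pos_nat)
  ultimately show ?thesis
    using power_eq_iff_eq_base[of "lcm p q" "norm x" 1] by simp
qed

text \<open>This makes the denominator of the ratio the case \<open>a = 0\<close>,
  \<open>b = 1\<close> of the arc count.\<close>

lemma Omega_arc_full: "Omega_arc 0 1 X = Omega X"
proof -
  have "x \<in> circle_arc 0 1" if "(T, x) \<in># Omega X" for T x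
  proof -
    have "T \<in> torus_links X" "x \<in># proots (torus_alexander_poly T)"
      using that by (auto simp: Omega_def set_mset_sum finite_torus_links)
    then obtain p q where "T = (p, q)" "p > 0" "q > 0" "poly (torus_alexander_poly (p, q)) x = 0"
      by (auto simp: torus_links_def torus_alexander_poly_nonzero)
    then show ?thesis
      using norm_root_torus_alexander_poly circle_arc_full by blast
  qed
  then show ?thesis
    by (auto simp: Omega_arc_def filter_mset_eq_conv)
qed

theorem theorem2:
  fixes a b :: real
  assumes "0 \<le> a" and "a \<le> b" and "b \<le> 1"
  shows "(\<lambda>X::real. real (size (Omega_arc a b X)) - (b - a) / 4 * X ^ 4) \<in> O[at_top](\<lambda>X. X ^ 3) \<and>
         ((\<lambda>X::real. real (size (Omega_arc a b X)) / real (size (Omega X))) \<longlongrightarrow> b - a) at_top"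
proof
  \<comment> \<open>Both this estimate and the limit \<open>lim\<close> are proved for arbitrary
    endpoints, because the total count needs them for \<open>[0, 1]\<close>.\<close>
  have bigo: "(\<lambda>X::real. real (size (Omega_arc a b X)) - (b - a) / 4 * X ^ 4) \<in> O[at_top](\<lambda>X. X ^ 3)"
    if "0 \<le> a" "a \<le> b" "b \<le> 1" for a b :: real
  proof (rule bigoI)
    show "\<forall>\<^sub>F X in at_top. norm (real (size (Omega_arc a b X)) - (b - a) / 4 * X ^ 4) \<le> 6 * norm (X ^ 3)"
      using eventually_ge_at_top[of "1::real"]
      by eventually_elim (use size_Omega_arc_approx[OF that] in simp)
  qed
  then show "(\<lambda>X::real. real (size (Omega_arc a b X)) - (b - a) / 4 * X ^ 4) \<in> O[at_top](\<lambda>X. X ^ 3)"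
    using assms by blast
  have lim: "((\<lambda>X. real (size (Omega_arc a b X)) / X ^ 4) \<longlongrightarrow> (b - a) / 4) at_top"
    if "0 \<le> a" "a \<le> b" "b \<le> 1" for a b :: real
  proof -
    have "(\<lambda>X::real. X ^ 3) \<in> o(\<lambda>X. X ^ 4)"
      by real_asymp
    with bigo[OF that] have "(\<lambda>X::real. real (size (Omega_arc a b X)) - (b - a) / 4 * X ^ 4) \<in> o(\<lambda>X. X ^ 4)"
      by (rule landau_o.big_small_trans)
    then have "((\<lambda>X. (real (size (Omega_arc a b X)) - (b - a) / 4 * X ^ 4) / X ^ 4 + (b - a) / 4)
        \<longlongrightarrow> 0 + (b - a) / 4) at_top"
      by (intro tendsto_add tendsto_const smalloD_tendsto)
    moreover have "\<forall>\<^sub>F X in at_top. (real (size (Omega_arc a b X)) - (b - a) / 4 * X ^ 4) / X ^ 4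
        + (b - a) / 4 = real (size (Omega_arc a b X)) / X ^ 4"
      using eventually_gt_at_top[of "0::real"]
      by eventually_elim (simp add: field_simps)
    ultimately show ?thesis
      using Lim_transform_eventually by fastforce
  qed
  have "((\<lambda>X. real (size (Omega X)) / X ^ 4) \<longlongrightarrow> 1 / 4) at_top"
    using lim[of 0 1] by (simp add: Omega_arc_full)
  \<comment> \<open>Numerator and denominator are both scaled by \<open>X ^ 4\<close>; the scaled
    denominator tends to \<open>1 / 4\<close>, which is nonzero, so the limits may be
    divided.\<close>
  then have "((\<lambda>X. (real (size (Omega_arc a b X)) / X ^ 4) / (real (size (Omega X)) / X ^ 4))
      \<longlongrightarrow> ((b - a) / 4) / (1 / 4)) at_top"
    by (rule tendsto_divide[OF lim[OF assms]]) simp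
  moreover have "\<forall>\<^sub>F X in at_top. (real (size (Omega_arc a b X)) / X ^ 4) / (real (size (Omega X)) / X ^ 4)
      = real (size (Omega_arc a b X)) / real (size (Omega X))"
    using eventually_gt_at_top[of "0::real"]
    by eventually_elim simp
  ultimately have "((\<lambda>X. real (size (Omega_arc a b X)) / real (size (Omega X)))
      \<longlongrightarrow> ((b - a) / 4) / (1 / 4)) at_top"
    by (rule Lim_transform_eventually)
  moreover have "((b - a) / 4) / (1 / 4) = b - a"
    by simp
  ultimately show "((\<lambda>X::real. real (size (Omega_arc a b X)) / real (size (Omega X))) \<longlongrightarrow> b - a) at_top"
    by (simp only:)
qed

end
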